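(* Let $d>4$ and, with the constant $c_4>0$ fixed in the context, let $\beta_*=\beta_*(r)=\beta_c-c_4r^{-d/2}$. There exist $r_0$ and constants $0<a\le A$ (independent of $r$) such that for all integers $r\ge r_0$, $$a\,r^{d/2}\le\chi^{\mathbb T_r}(\beta_* )\le A\,r^{d/2}.$$ In particular, there is a constant $a>0$ such that $\chi^{\mathbb T_r}(\beta)\ge a\,r^{d/2}$ for all integers $r\ge r_0$ and all $\beta\ge\beta_*$.
   Context: Ising model. For a finite graph $\mathcal G=(V,E)$ and $\beta>0$, the Ising expectation of a function $F$ of $\sigma\in\{-1,+1\}^V$ is $\langle F\rangle^{\mathcal G}_\beta=\frac{1}{Z}\sum_\sigma F(\sigma)\exp\big(\beta\sum_{xy\in E}\sigma_x\sigma_y\big)$ with $Z$ the normalising constant. For an integer $r\ge3$, $\Lambda_r=[-r/2,r/2)^d\cap\mathbb Z^d$ is the graph with nearest-neighbour edges, and $\mathbb T_r=(\mathbb Z/r\mathbb Z)^d$ is the discrete torus with nearest-neighbour edges. A point of $\mathbb T_r$ is identified with its representative in $\Lambda_r$; in particular $\|x\|_\infty$ and $\tau_\beta(0,x)$ for $x\in\mathbb T_r$ are evaluated at that representative. $\tau_\beta^{\mathcal G}(x,y)=\langle\sigma_x\sigma_y\rangle_\beta^{\mathcal G}$ for $\mathcal G=\Lambda_r,\mathbb T_r$; the torus susceptibility is $\chi^{\mathbb T_r}(\beta)=\sum_{x\in\mathbb T_r}\tau_\beta^{\mathbb T_r}(0,x)$; $\tau_\beta(x,y)=\lim_{r\to\infty}\tau_\beta^{\Lambda_r}(x,y)$;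 $\chi(\beta)=\sum_{x\in\mathbb Z^d}\tau_\beta(0,x)\in[0,\infty]$; $\beta_c=\sup\{\beta>0:\chi(\beta)<\infty\}$. Known inputs for $d>4$: $\chi(\beta)$ is bounded above and below by positive multiples of $(\beta_c-\beta)^{-1}$ for $\beta<\beta_c$; and there are positive constants $c_0,C_0$, which we fix, such that for all $\beta\le\beta_c$: $\tau_\beta(0,x)\le \frac{C_0}{\max(1,\|x\|_\infty)^{d-2}}e^{-c_0(\beta_c-\beta)^{1/2}\|x\|_\infty}$ for all $x\in\mathbb Z^d$, and $\tau_\beta(0,x)\ge\frac{c_0}{\max(1,\|x\|_\infty)^{d-2}}$ whenever $\|x\|_\infty\le c_0(\beta_c-\beta)^{-1/2}$. Constants $c_1,\dots,c_5$: these are fixed positive constants depending only on $d$, with $c_3=\frac49c_0^2$, for which the following holds (their existence is a theorem of the same paper): $\tau_\beta^{\mathbb T_r}(0,x)\le \tau_\beta(0,x)+c_1\chi(\beta)r^{-d}$ for all $r\ge3$, $\beta\in(0,\beta_c)$, $x\in\mathbb T_r$; and $\tau_\beta^{\mathbb T_r}(0,x)\ge \tau_\beta(0,x)+c_2\chi(\beta)r^{-d}$ for all $r\ge3$, $\beta\in[\beta_c-c_3r^{-2},\beta_c-c_4r^{-d/2}]$ and $x\in\mathbb T_r$ with $\|x\|_\infty\ge c_5$. *)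

theory Defs
  imports "HOL-Analysis.Analysis"
begin

text \<open>An edge is the two-element set of its endpoints, so the interaction
  \<open>\<sigma> x * \<sigma> y\<close> of the edge \<open>{x, y}\<close> is the product of \<open>\<sigma>\<close> over it.\<close>

definition ising_weight :: "'v set set \<Rightarrow> real \<Rightarrow> ('v \<Rightarrow> real) \<Rightarrow> real" where
  "ising_weight E \<beta> \<sigma> = exp (\<beta> * (\<Sum>e\<in>E. \<Prod>v\<in>e. \<sigma> v))"

definition ising_expectation ::
    "'v set \<Rightarrow> 'v set set \<Rightarrow> real \<Rightarrow> (('v \<Rightarrow> real) \<Rightarrow> real) \<Rightarrow> real" where
  "ising_expectation V E \<beta> F =
     (\<Sum>\<sigma>\<in>V \<rightarrow>\<^sub>E {-1, 1}. F \<sigma> * ising_weight E \<beta> \<sigma>) /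
     (\<Sum>\<sigma>\<in>V \<rightarrow>\<^sub>E {-1, 1}. ising_weight E \<beta> \<sigma>)"

definition two_point :: "'v set \<Rightarrow> 'v set set \<Rightarrow> real \<Rightarrow> 'v \<Rightarrow> 'v \<Rightarrow> real" where
  "two_point V E \<beta> x y = ising_expectation V E \<beta> (\<lambda>\<sigma>. \<sigma> x * \<sigma> y)"

definition sup_norm :: "int ^ 'd::finite \<Rightarrow> real" where
  "sup_norm x = real_of_int (MAX i. \<bar>x $ i\<bar>)"

definition lattice_box :: "nat \<Rightarrow> (int ^ 'd::finite) set" where
  "lattice_box r = {x. \<forall>i. - (real r / 2) \<le> real_of_int (x $ i) \<and> real_of_int (x $ i) < real r / 2}"

definition box_edges :: "nat \<Rightarrow> (int ^ 'd::finite) set set" where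
  "box_edges r = {{x, y} | x y. x \<in> lattice_box r \<and> y \<in> lattice_box r \<and> (\<exists>i. x = y + axis i 1)}"

text \<open>The vertices of the torus \<open>(\<int>/r\<int>)\<^sup>d\<close> are its representatives in \<open>lattice_box r\<close>; only the
  edge set differs from that of the box. For \<open>r \<ge> 3\<close> this is the simple nearest-neighbour graph
  of the torus.\<close>

definition torus_edges :: "nat \<Rightarrow> (int ^ 'd::finite) set set" where
  "torus_edges r = {{x, y} | x y. x \<in> lattice_box r \<and> y \<in> lattice_box r \<and>
     (\<exists>i. \<forall>j. x $ j mod int r = (y + axis i 1) $ j mod int r)}"

definition tau_box :: "nat \<Rightarrow> real \<Rightarrow> int ^ 'd::finite \<Rightarrow> int ^ 'd \<Rightarrow> real" where
  "tau_box r = two_point (lattice_box r) (box_edges r)"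

definition tau_torus :: "nat \<Rightarrow> real \<Rightarrow> int ^ 'd::finite \<Rightarrow> int ^ 'd \<Rightarrow> real" where
  "tau_torus r = two_point (lattice_box r) (torus_edges r)"

definition tau :: "real \<Rightarrow> int ^ 'd::finite \<Rightarrow> int ^ 'd \<Rightarrow> real" where
  "tau \<beta> x y = lim (\<lambda>r. tau_box r \<beta> x y)"

definition chi_torus :: "'d::finite itself \<Rightarrow> nat \<Rightarrow> real \<Rightarrow> real" where
  "chi_torus _ r \<beta> = (\<Sum>x\<in>(lattice_box r :: (int ^ 'd) set). tau_torus r \<beta> 0 x)"

definition chi :: "'d::finite itself \<Rightarrow> real \<Rightarrow> ereal" where
  "chi _ \<beta> = (\<Sum>\<^sub>\<infinity>x\<in>(UNIV :: (int ^ 'd) set). ereal (tau \<beta> 0 x))"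

text \<open>The supremum is taken in \<open>[-\<infinity>, \<infinity>]\<close>, because the supremum of an unbounded set of reals is
  an unspecified real in HOL. A bound \<open>chi \<beta> \<le> K / (crit_ereal - \<beta>)\<close>, read in the extended
  reals, excludes \<open>crit_ereal = \<infinity>\<close>, since \<open>K / \<infinity> = 0\<close> while \<open>chi \<beta> \<ge> tau \<beta> 0 0 = 1\<close>;
  then \<open>crit\<close> is the same critical point as a real number.\<close>

definition crit_ereal :: "'d::finite itself \<Rightarrow> ereal" where
  "crit_ereal d = (SUP \<beta>\<in>{\<beta>. 0 < \<beta> \<and> chi d \<beta> < \<infinity>}. ereal \<beta>)"

definition crit :: "'d::finite itself \<Rightarrow> real" where
  "crit d = real_of_ereal (crit_ereal d)"

definition beta_star :: "'d::finite itself \<Rightarrow> real \<Rightarrow> nat \<Rightarrow> real" where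
  "beta_star d c4 r = crit d - c4 * real r powr (- (real CARD('d) / 2))"

end

theory Submission
  imports Defs
begin

text \<open>Since \<open>\<chi>\<close> is of order \<open>(\<beta>\<^sub>c - \<beta>)\<^bsup>-1\<^esup>\<close>, it is of order \<open>r\<^bsup>d/2\<^esup>\<close> at \<open>\<beta>\<^sub>*\<close>.
  Summing the upper bound for the torus two-point function over the \<open>r\<^sup>d\<close> points of the torus gives
  \<open>(1 + c1) * \<chi>\<close>; summing the plateau \<open>c2 * \<chi> * r\<^bsup>-d\<^esup>\<close> over the points with \<open>sup_norm x \<ge> c5\<close>,
  which are at least half of them, gives \<open>c2 * \<chi> / 2\<close>. The second of Griffiths' inequalities makes
  \<open>\<chi>\<close> of the torus increasing in \<open>\<beta>\<close>, so the lower bound persists above \<open>\<beta>\<^sub>*\<close>.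

  All inputs would be vacuous if \<open>\<beta>\<^sub>c\<close> were not a positive real. Removing the edges at a
  vertex one by one bounds \<open>\<tau>(x, z)\<close> by \<open>tanh \<beta>\<close> times the sum of \<open>\<tau>(y, z)\<close> over the neighbours \<open>y\<close> of \<open>x\<close>,
  so \<open>\<chi>\<close> is finite for small \<open>\<beta>\<close> and \<open>\<beta>\<^sub>c > 0\<close>; an infinite \<open>\<beta>\<^sub>c\<close> would force \<open>\<chi> = 0\<close>,
  against \<open>\<tau>(0, 0) = 1\<close>.\<close>

section \<open>Griffiths' inequalities\<close>

definition spin_prod :: "'v set \<Rightarrow> ('v \<Rightarrow> real) \<Rightarrow> real" where
  "spin_prod A \<sigma> = (\<Prod>v\<in>A. \<sigma> v)"

text \<open>Edge-dependent couplings are needed because the duplicated system in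
  \<open>griffiths_second\<close> produces them even from constant ones.\<close>

definition coupled_weight :: "'v set set \<Rightarrow> ('v set \<Rightarrow> real) \<Rightarrow> ('v \<Rightarrow> real) \<Rightarrow> real" where
  "coupled_weight E J \<sigma> = exp (\<Sum>e\<in>E. J e * spin_prod e \<sigma>)"

text \<open>The unnormalised correlation of the spins in \<open>A\<close>; for \<open>A = {}\<close>
  it is the partition function.\<close>

definition spin_sum :: "'v set \<Rightarrow> 'v set set \<Rightarrow> ('v set \<Rightarrow> real) \<Rightarrow> 'v set \<Rightarrow> real" where
  "spin_sum V E J A = (\<Sum>\<sigma>\<in>V \<rightarrow>\<^sub>E {-1, 1}. spin_prod A \<sigma> * coupled_weight E J \<sigma>)"

lemma finite_spins [simp]: "finite V \<Longrightarrow> finite (V \<rightarrow>\<^sub>E {-1, 1::real})"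
  by (intro finite_PiE) auto

lemma spin_prod_cases:
  assumes "finite A" "\<And>v. v \<in> A \<Longrightarrow> \<sigma> v \<in> {-1, 1}"
  shows "spin_prod A \<sigma> \<in> {-1, 1}"
  using assms unfolding spin_prod_def
proof (induction A rule: finite_induct)
  case (insert a A)
  then have "prod \<sigma> A \<in> {-1, 1}" "\<sigma> a \<in> {-1, 1}" by blast+
  then show ?case using insert.hyps by auto
qed simp

lemma spin_prod_cases_spins:
  assumes "finite V" "A \<subseteq> V" "\<sigma> \<in> V \<rightarrow>\<^sub>E {-1, 1}"
  shows "spin_prod A \<sigma> \<in> {-1, 1}"
proof (rule spin_prod_cases)
  show "finite A" using assms finite_subset by blast
  show "\<sigma> v \<in> {-1, 1}" if "v \<in> A" for v
    by (rule PiE_mem[OF assms(3)]) (use that assms in auto)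
qed

text \<open>Each spin squares to 1, so the vertices common to \<open>A\<close> and \<open>B\<close>
  cancel.\<close>

lemma spin_prod_mult:
  assumes "finite V" "A \<subseteq> V" "B \<subseteq> V" "\<sigma> \<in> V \<rightarrow>\<^sub>E {-1, 1}"
  shows "spin_prod A \<sigma> * spin_prod B \<sigma> = spin_prod ((A - B) \<union> (B - A)) \<sigma>"
proof -
  have fin: "finite A" "finite B" using assms finite_subset by blast+
  have "spin_prod A \<sigma> = spin_prod (A - B) \<sigma> * spin_prod (A \<inter> B) \<sigma>"
    unfolding spin_prod_def using fin
    by (subst prod.union_disjoint[symmetric]) (auto intro!: prod.cong)
  moreover have "spin_prod B \<sigma> = spin_prod (B - A) \<sigma> * spin_prod (A \<inter> B) \<sigma>"
    unfolding spin_prod_def using fin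
    by (subst prod.union_disjoint[symmetric]) (auto intro!: prod.cong)
  moreover have "spin_prod ((A - B) \<union> (B - A)) \<sigma> = spin_prod (A - B) \<sigma> * spin_prod (B - A) \<sigma>"
    unfolding spin_prod_def using fin by (subst prod.union_disjoint) auto
  moreover have "spin_prod (A \<inter> B) \<sigma> * spin_prod (A \<inter> B) \<sigma> = 1"
  proof -
    have "A \<inter> B \<subseteq> V" using assms(2) by auto
    from spin_prod_cases_spins[OF assms(1) this assms(4)] show ?thesis by auto
  qed
  ultimately show ?thesis by (simp add: mult.assoc mult.left_commute)
qed

text \<open>The sum factorises over the vertices, with factor 0 at a vertex of \<open>A\<close> and
  2 elsewhere.\<close>

lemma sum_spin_prod_nonneg:
  assumes "finite V" "A \<subseteq> V"
  shows "0 \<le> (\<Sum>\<sigma>\<in>V \<rightarrow>\<^sub>E {-1, 1}. spin_prod A \<sigma>)"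
proof -
  have "(\<Sum>\<sigma>\<in>V \<rightarrow>\<^sub>E {-1, 1}. spin_prod A \<sigma>)
      = (\<Sum>\<sigma>\<in>V \<rightarrow>\<^sub>E {-1, 1}. \<Prod>v\<in>V. if v \<in> A then \<sigma> v else 1)"
    unfolding spin_prod_def using assms
    by (intro sum.cong refl prod.mono_neutral_cong_left) auto
  also have "\<dots> = (\<Prod>v\<in>V. \<Sum>s\<in>{-1, 1}. if v \<in> A then s else 1)"
    by (rule prod_sum_PiE[symmetric]) (use assms in auto)
  also have "\<dots> \<ge> 0" by (intro prod_nonneg) auto
  finally show ?thesis .
qed

lemma exp_spin:
  fixes s :: real
  assumes "s \<in> {-1, 1}"
  shows "exp (K * s) = cosh K + sinh K * s"
  using assms by (auto simp: cosh_plus_sinh cosh_minus_sinh)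

lemma coupled_weight_insert:
  assumes "finite V" "finite E" "e \<notin> E" "e \<subseteq> V" "\<sigma> \<in> V \<rightarrow>\<^sub>E {-1, 1}"
  shows "coupled_weight (insert e E) J \<sigma>
    = (cosh (J e) + sinh (J e) * spin_prod e \<sigma>) * coupled_weight E J \<sigma>"
  using assms exp_spin[OF spin_prod_cases_spins[OF assms(1,4,5)], of "J e"]
  by (simp add: coupled_weight_def exp_add)

text \<open>High-temperature expansion of one edge: \<open>spin_prod e \<sigma>\<close> only takes
  the values -1 and 1, so its exponential is affine in it. Both the first Griffiths inequality and
  the removal of edges rest on this recursion.\<close>

lemma spin_sum_insert:
  assumes "finite V" "finite E" "e \<notin> E" "e \<subseteq> V" "A \<subseteq> V"
  shows "spin_sum V (insert e E) J A
    = cosh (J e) * spin_sum V E J A + sinh (J e) * spin_sum V E J ((A - e) \<union> (e - A))"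
proof -
  have "spin_sum V (insert e E) J A = (\<Sum>\<sigma>\<in>V \<rightarrow>\<^sub>E {-1, 1}.
      cosh (J e) * (spin_prod A \<sigma> * coupled_weight E J \<sigma>)
      + sinh (J e) * (spin_prod ((A - e) \<union> (e - A)) \<sigma> * coupled_weight E J \<sigma>))"
    unfolding spin_sum_def
  proof (intro sum.cong refl)
    fix \<sigma> :: "'a \<Rightarrow> real" assume s: "\<sigma> \<in> V \<rightarrow>\<^sub>E {-1, 1}"
    show "spin_prod A \<sigma> * coupled_weight (insert e E) J \<sigma> = 
      cosh (J e) * (spin_prod A \<sigma> * coupled_weight E J \<sigma>)
      + sinh (J e) * (spin_prod ((A - e) \<union> (e - A)) \<sigma> * coupled_weight E J \<sigma>)"
      unfolding coupled_weight_insert[OF assms(1-4) s] spin_prod_mult[OF assms(1,5,4) s, symmetric]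
      by (simp add: algebra_simps)
  qed
  also have "\<dots> = cosh (J e) * spin_sum V E J A + sinh (J e) * spin_sum V E J ((A - e) \<union> (e - A))"
    by (simp add: spin_sum_def sum.distrib sum_distrib_left)
  finally show ?thesis .
qed

text \<open>Induction on the edges, with \<open>A\<close> arbitrary because expanding an edge
  replaces \<open>A\<close> by a symmetric difference; for \<open>J e \<ge> 0\<close> both
  hyperbolic coefficients are nonnegative.\<close>

lemma griffiths_first:
  assumes "finite V" "finite E" "\<And>e. e \<in> E \<Longrightarrow> e \<subseteq> V" "\<And>e. e \<in> E \<Longrightarrow> 0 \<le> J e" "A \<subseteq> V"
  shows "0 \<le> spin_sum V E J A"
  using assms(2-5)
proof (induction E arbitrary: A rule: finite_induct)
  case empty
  then show ?case
    using sum_spin_prod_nonneg[OF assms(1)] by (simp add: spin_sum_def coupled_weight_def)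
next
  case (insert e E)
  have e: "e \<subseteq> V" "0 \<le> J e" using insert.prems by auto
  have nn: "0 \<le> spin_sum V E J B" if "B \<subseteq> V" for B
    using insert.prems that by (intro insert.IH) auto
  have "0 \<le> spin_sum V E J A" "0 \<le> spin_sum V E J ((A - e) \<union> (e - A))"
    by (rule nn; use e(1) insert.prems(3) in blast)+
  then have "0 \<le> cosh (J e) * spin_sum V E J A + sinh (J e) * spin_sum V E J ((A - e) \<union> (e - A))"
    using e by (intro add_nonneg_nonneg mult_nonneg_nonneg) simp_all
  then show ?case
    unfolding spin_sum_insert[OF assms(1) insert.hyps e(1) insert.prems(3)] .
qed

lemma spin_sum_empty_pos:
  assumes "finite V"
  shows "0 < spin_sum V E J {}"
  unfolding spin_sum_def spin_prod_def coupled_weight_def using assms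
  by (intro sum_pos) (auto simp: PiE_eq_empty_iff)

text \<open>In the duplicated system with independent spins \<open>\<sigma>\<close>, \<open>\<tau>\<close> the substitution
  \<open>\<tau> = \<sigma> * \<eta>\<close> turns the sum over \<open>\<sigma>\<close>, for each fixed \<open>\<eta>\<close>, into an Ising sum with
  couplings \<open>J e + J' e * spin_prod e \<eta> \<ge> 0\<close>, to which the first inequality applies.\<close>

lemma griffiths_second:
  assumes V: "finite V" and E: "finite E" "\<And>e. e \<in> E \<Longrightarrow> e \<subseteq> V" and A: "A \<subseteq> V"
    and J: "\<And>e. e \<in> E \<Longrightarrow> 0 \<le> J' e" "\<And>e. e \<in> E \<Longrightarrow> J' e \<le> J e"
  shows "spin_sum V E J' A * spin_sum V E J {} \<le> spin_sum V E J A * spin_sum V E J' {}"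
proof -
  let ?S = "V \<rightarrow>\<^sub>E {-1, 1::real}"
  let ?m = "\<lambda>\<sigma> \<eta>. restrict (\<lambda>v. \<sigma> v * \<eta> v) V"
  have m_in: "?m \<sigma> \<eta> \<in> ?S" if "\<sigma> \<in> ?S" "\<eta> \<in> ?S" for \<sigma> \<eta>
    using PiE_mem[OF that(1)] PiE_mem[OF that(2)] by fastforce
  \<comment> \<open>For fixed \<open>\<sigma>\<close> the substitution is an involution of the
    configurations, hence a valid change of variables.\<close>
  have m_m: "?m \<sigma> (?m \<sigma> \<eta>) = \<eta>" if "\<sigma> \<in> ?S" "\<eta> \<in> ?S" for \<sigma> \<eta>
  proof
    fix v
    show "?m \<sigma> (?m \<sigma> \<eta>) v = \<eta> v"
      using PiE_mem[OF that(1), of v] PiE_arb[OF that(2), of v] by (auto simp: restrict_def)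
  qed
  have m_prod: "spin_prod B (?m \<sigma> \<eta>) = spin_prod B \<sigma> * spin_prod B \<eta>" if "B \<subseteq> V" for B \<sigma> \<eta>
    unfolding spin_prod_def using that
    by (subst prod.distrib[symmetric]) (auto intro!: prod.cong)
  \<comment> \<open>Exchanging the two copies in the subtracted product gives both products the same
    weight, \<open>J\<close> on \<open>\<sigma>\<close> and \<open>J'\<close> on
    \<open>\<tau>\<close>.\<close>
  have "spin_sum V E J A * spin_sum V E J' {} - spin_sum V E J' A * spin_sum V E J {}
     = (\<Sum>\<sigma>\<in>?S. \<Sum>\<tau>\<in>?S. (spin_prod A \<sigma> - spin_prod A \<tau>) * coupled_weight E J \<sigma> * coupled_weight E J' \<tau>)"
    unfolding spin_sum_def sum_product
    by (subst (2) sum.swap)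
      (simp add: sum_subtractf[symmetric] spin_prod_def algebra_simps)
  also have "\<dots> = (\<Sum>\<sigma>\<in>?S. \<Sum>\<eta>\<in>?S. (spin_prod A \<sigma> - spin_prod A (?m \<sigma> \<eta>))
      * coupled_weight E J \<sigma> * coupled_weight E J' (?m \<sigma> \<eta>))"
  proof (rule sum.cong[OF refl])
    fix \<sigma> assume s: "\<sigma> \<in> ?S"
    show "(\<Sum>\<tau>\<in>?S. (spin_prod A \<sigma> - spin_prod A \<tau>) * coupled_weight E J \<sigma> * coupled_weight E J' \<tau>)
      = (\<Sum>\<eta>\<in>?S. (spin_prod A \<sigma> - spin_prod A (?m \<sigma> \<eta>))
      * coupled_weight E J \<sigma> * coupled_weight E J' (?m \<sigma> \<eta>))"
      by (rule sum.reindex_bij_witness[of _ "?m \<sigma>" "?m \<sigma>"]) (use m_in[OF s] m_m[OF s] in auto)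
  qed
  also have "\<dots> = (\<Sum>\<sigma>\<in>?S. \<Sum>\<eta>\<in>?S. (1 - spin_prod A \<eta>)
      * (spin_prod A \<sigma> * coupled_weight E (\<lambda>e. J e + J' e * spin_prod e \<eta>) \<sigma>))"
  proof (intro sum.cong refl)
    fix \<sigma> \<eta> assume "\<sigma> \<in> ?S" "\<eta> \<in> ?S"
    have "coupled_weight E J' (?m \<sigma> \<eta>) = exp (\<Sum>e\<in>E. J' e * (spin_prod e \<sigma> * spin_prod e \<eta>))"
      unfolding coupled_weight_def using m_prod E(2)
      by (intro arg_cong[where f = exp] sum.cong) auto
    hence "coupled_weight E J \<sigma> * coupled_weight E J' (?m \<sigma> \<eta>)
      = coupled_weight E (\<lambda>e. J e + J' e * spin_prod e \<eta>) \<sigma>"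
      by (simp add: coupled_weight_def exp_add[symmetric] sum.distrib[symmetric] algebra_simps)
    then show "(spin_prod A \<sigma> - spin_prod A (?m \<sigma> \<eta>)) * coupled_weight E J \<sigma> * coupled_weight E J' (?m \<sigma> \<eta>)
      = (1 - spin_prod A \<eta>) * (spin_prod A \<sigma> * coupled_weight E (\<lambda>e. J e + J' e * spin_prod e \<eta>) \<sigma>)"
      by (simp add: m_prod[OF A] algebra_simps)
  qed
  also have "\<dots> = (\<Sum>\<eta>\<in>?S. (1 - spin_prod A \<eta>) * spin_sum V E (\<lambda>e. J e + J' e * spin_prod e \<eta>) A)"
    unfolding spin_sum_def by (subst sum.swap) (simp add: sum_distrib_left)
  also have "\<dots> \<ge> 0"
  proof (intro sum_nonneg mult_nonneg_nonneg)
    fix \<eta> assume h: "\<eta> \<in> ?S"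
    show "0 \<le> 1 - spin_prod A \<eta>" using spin_prod_cases_spins[OF V A h] by auto
    \<comment> \<open>The worst case is \<open>spin_prod e \<eta> = -1\<close>, where the coupling
      is \<open>J e - J' e\<close>.\<close>
    have "0 \<le> J e + J' e * spin_prod e \<eta>" if "e \<in> E" for e
      using spin_prod_cases_spins[OF V E(2)[OF that] h] J[OF that] by auto
    then show "0 \<le> spin_sum V E (\<lambda>e. J e + J' e * spin_prod e \<eta>) A"
      by (intro griffiths_first V E A)
  qed
  finally show ?thesis by simp
qed

section \<open>The two-point function of a finite graph\<close>

text \<open>For \<open>x = y\<close> the set is empty because \<open>\<sigma> x * \<sigma> x = 1\<close>.\<close>

definition pair_set :: "'v \<Rightarrow> 'v \<Rightarrow> 'v set" where
  "pair_set x y = (if x = y then {} else {x, y})"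

text \<open>Couplings that vanish outside \<open>E0\<close> let graphs with different edge sets be compared
  over a common \<open>E\<close>.\<close>

lemma two_point_eq:
  assumes V: "finite V" and xy: "x \<in> V" "y \<in> V" and E: "finite E"
    and J: "E0 \<subseteq> E" "\<And>e. e \<in> E \<Longrightarrow> J e = (if e \<in> E0 then \<beta> else 0)"
  shows "two_point V E0 \<beta> x y = spin_sum V E J (pair_set x y) / spin_sum V E J {}"
proof -
  have w: "ising_weight E0 \<beta> \<sigma> = coupled_weight E J \<sigma>" for \<sigma>
  proof -
    have "\<beta> * (\<Sum>e\<in>E0. \<Prod>v\<in>e. \<sigma> v) = (\<Sum>e\<in>E0. J e * spin_prod e \<sigma>)"
      unfolding sum_distrib_left spin_prod_def using J by (intro sum.cong) auto
    also have "\<dots> = (\<Sum>e\<in>E. J e * spin_prod e \<sigma>)"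
      using J E by (intro sum.mono_neutral_left) auto
    finally show ?thesis by (simp add: ising_weight_def coupled_weight_def)
  qed
  have "\<sigma> x * \<sigma> y = spin_prod (pair_set x y) \<sigma>" if "\<sigma> \<in> V \<rightarrow>\<^sub>E {-1, 1}" for \<sigma> :: "'a \<Rightarrow> real"
    using PiE_mem[OF that xy(1)] by (auto simp: pair_set_def spin_prod_def)
  then show ?thesis
    unfolding two_point_def ising_expectation_def spin_sum_def w
    by (intro arg_cong2[where f = "(/)"] sum.cong) (auto simp: spin_prod_def)
qed

lemma pair_set_subset: "x \<in> V \<Longrightarrow> y \<in> V \<Longrightarrow> pair_set x y \<subseteq> V"
  by (auto simp: pair_set_def)

lemma two_point_commute: "two_point V E \<beta> x y = two_point V E \<beta> y x"
  by (simp add: two_point_def mult.commute)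

lemma finite_edges: "finite V \<Longrightarrow> E \<subseteq> Pow V \<Longrightarrow> finite E"
  using finite_subset by blast

lemma two_point_nonneg:
  assumes "finite V" "E \<subseteq> Pow V" "0 \<le> \<beta>" "x \<in> V" "y \<in> V"
  shows "0 \<le> two_point V E \<beta> x y"
proof -
  have E: "finite E" using assms finite_edges by blast
  have "two_point V E \<beta> x y = spin_sum V E (\<lambda>_. \<beta>) (pair_set x y) / spin_sum V E (\<lambda>_. \<beta>) {}"
    using assms E by (intro two_point_eq) auto
  also have "\<dots> \<ge> 0"
    using assms E pair_set_subset[of x V y]
    by (intro divide_nonneg_nonneg griffiths_first) auto
  finally show ?thesis .
qed

lemma two_point_self:
  assumes "finite V" "x \<in> V"
  shows "two_point V E \<beta> x x = 1"
proof -
  have "(\<Sum>\<sigma>\<in>V \<rightarrow>\<^sub>E {-1, 1}. \<sigma> x * \<sigma> x * ising_weight E \<beta> \<sigma>)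
      = (\<Sum>\<sigma>\<in>V \<rightarrow>\<^sub>E {-1, 1}. ising_weight E \<beta> \<sigma>)"
    using assms(2) by (intro sum.cong) (auto dest!: PiE_mem)
  moreover have "(\<Sum>\<sigma>\<in>V \<rightarrow>\<^sub>E {-1, 1}. ising_weight E \<beta> \<sigma>) > 0"
    unfolding ising_weight_def using assms(1) by (intro sum_pos) (auto simp: PiE_eq_empty_iff)
  ultimately show ?thesis by (simp add: two_point_def ising_expectation_def)
qed

lemma two_point_le_1:
  assumes "finite V" "x \<in> V" "y \<in> V"
  shows "two_point V E \<beta> x y \<le> 1"
proof -
  have "(\<Sum>\<sigma>\<in>V \<rightarrow>\<^sub>E {-1, 1}. \<sigma> x * \<sigma> y * ising_weight E \<beta> \<sigma>)
      \<le> (\<Sum>\<sigma>\<in>V \<rightarrow>\<^sub>E {-1, 1}. ising_weight E \<beta> \<sigma>)"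
  proof (rule sum_mono)
    fix \<sigma> :: "'a \<Rightarrow> real" assume s: "\<sigma> \<in> V \<rightarrow>\<^sub>E {-1, 1}"
    have "\<sigma> x * \<sigma> y \<le> 1" using PiE_mem[OF s assms(2)] PiE_mem[OF s assms(3)] by auto
    then show "\<sigma> x * \<sigma> y * ising_weight E \<beta> \<sigma> \<le> ising_weight E \<beta> \<sigma>"
      by (simp add: ising_weight_def)
  qed
  moreover have "(\<Sum>\<sigma>\<in>V \<rightarrow>\<^sub>E {-1, 1}. ising_weight E \<beta> \<sigma>) > 0"
    unfolding ising_weight_def using assms(1) by (intro sum_pos) (auto simp: PiE_eq_empty_iff)
  ultimately show ?thesis by (simp add: two_point_def ising_expectation_def)
qed

text \<open>The couplings \<open>\<beta>'\<close> on \<open>E'\<close> and 0 on the rest of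
  \<open>E\<close> lie below the constant \<open>\<beta>\<close>, so the second Griffiths inequality
  applies. This covers growth both in \<open>\<beta>\<close> (for the torus) and in the graph (for
  the boxes).\<close>

lemma two_point_mono:
  assumes "finite V" "E \<subseteq> Pow V" "E' \<subseteq> E" "0 \<le> \<beta>'" "\<beta>' \<le> \<beta>" "x \<in> V" "y \<in> V"
  shows "two_point V E' \<beta>' x y \<le> two_point V E \<beta> x y"
proof -
  define J where "J = (\<lambda>_::'a set. \<beta>)"
  define J' where "J' = (\<lambda>e. if e \<in> E' then \<beta>' else 0)"
  have E: "finite E" using assms finite_edges by blast
  have "two_point V E \<beta> x y = spin_sum V E J (pair_set x y) / spin_sum V E J {}"
    using assms E by (intro two_point_eq) (auto simp: J_def)
  moreover have "two_point V E' \<beta>' x y = spin_sum V E J' (pair_set x y) / spin_sum V E J' {}"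
    using assms E by (intro two_point_eq) (auto simp: J'_def)
  moreover have "spin_sum V E J' (pair_set x y) * spin_sum V E J {}
      \<le> spin_sum V E J (pair_set x y) * spin_sum V E J' {}"
    using assms E pair_set_subset[of x V y]
    by (intro griffiths_second) (auto simp: J_def J'_def)
  ultimately show ?thesis
    using spin_sum_empty_pos[OF assms(1), of E J] spin_sum_empty_pos[OF assms(1), of E J']
    by (simp add: frac_le_eq divide_nonpos_pos)
qed

section \<open>Adding vertices and removing edges\<close>

lemma sum_spins_insert:
  fixes f :: "('v \<Rightarrow> real) \<Rightarrow> real"
  assumes "a \<notin> V" "\<And>\<sigma> s. \<sigma> \<in> V \<rightarrow>\<^sub>E {-1, 1} \<Longrightarrow> s \<in> {-1, 1} \<Longrightarrow> f (\<sigma>(a := s)) = f \<sigma>"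
  shows "(\<Sum>\<sigma>\<in>insert a V \<rightarrow>\<^sub>E {-1, 1}. f \<sigma>) = 2 * (\<Sum>\<sigma>\<in>V \<rightarrow>\<^sub>E {-1, 1}. f \<sigma>)"
proof -
  have "(\<Sum>\<sigma>\<in>insert a V \<rightarrow>\<^sub>E {-1, 1}. f \<sigma>)
      = (\<Sum>(s, \<sigma>)\<in>{-1, 1} \<times> (V \<rightarrow>\<^sub>E {-1, 1}). f (\<sigma>(a := s)))"
    unfolding PiE_insert_eq
    by (subst sum.reindex) (use assms(1) inj_combinator[of a V "\<lambda>_. {-1, 1::real}"] in \<open>auto simp: case_prod_unfold\<close>)
  also have "\<dots> = (\<Sum>s\<in>{-1, 1::real}. \<Sum>\<sigma>\<in>V \<rightarrow>\<^sub>E {-1, 1}. f (\<sigma>(a := s)))"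
    by (rule sum.cartesian_product[symmetric])
  also have "\<dots> = (\<Sum>s\<in>{-1, 1::real}. \<Sum>\<sigma>\<in>V \<rightarrow>\<^sub>E {-1, 1}. f \<sigma>)"
    by (intro sum.cong refl assms(2))
  finally show ?thesis by simp
qed

text \<open>The new vertex lies in no edge, so its two spin values contribute equally and the factor
  2 cancels against the partition function.\<close>

lemma two_point_insert_vertex:
  assumes "a \<notin> V" "E \<subseteq> Pow V" "x \<in> V" "y \<in> V"
  shows "two_point (insert a V) E \<beta> x y = two_point V E \<beta> x y"
proof -
  have w: "ising_weight E \<beta> (\<sigma>(a := s)) = ising_weight E \<beta> \<sigma>" for \<sigma> s
    unfolding ising_weight_def using assms
    by (intro arg_cong[where f = exp] arg_cong[where f = "(*) \<beta>"] sum.cong prod.cong) auto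
  have "x \<noteq> a" "y \<noteq> a" using assms by auto
  then have "(\<Sum>\<sigma>\<in>insert a V \<rightarrow>\<^sub>E {-1, 1}. \<sigma> x * \<sigma> y * ising_weight E \<beta> \<sigma>)
      = 2 * (\<Sum>\<sigma>\<in>V \<rightarrow>\<^sub>E {-1, 1}. \<sigma> x * \<sigma> y * ising_weight E \<beta> \<sigma>)"
    using assms by (intro sum_spins_insert) (auto simp: w)
  moreover have "(\<Sum>\<sigma>\<in>insert a V \<rightarrow>\<^sub>E {-1, 1}. ising_weight E \<beta> \<sigma>)
      = 2 * (\<Sum>\<sigma>\<in>V \<rightarrow>\<^sub>E {-1, 1}. ising_weight E \<beta> \<sigma>)"
    using assms by (intro sum_spins_insert) (auto simp: w)
  ultimately show ?thesis by (simp add: two_point_def ising_expectation_def)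
qed

lemma two_point_enlarge_vertices:
  assumes "finite W" "V \<subseteq> W" "E \<subseteq> Pow V" "x \<in> V" "y \<in> V"
  shows "two_point W E \<beta> x y = two_point V E \<beta> x y"
proof -
  have "two_point (V \<union> U) E \<beta> x y = two_point V E \<beta> x y" if "finite U" for U
    using that
  proof (induction U rule: finite_induct)
    case (insert a U)
    show ?case
    proof (cases "a \<in> V")
      case True
      then show ?thesis using insert.IH by (simp add: insert_absorb)
    next
      case False
      then have "two_point (insert a (V \<union> U)) E \<beta> x y = two_point (V \<union> U) E \<beta> x y"
        using insert.hyps assms by (intro two_point_insert_vertex) auto
      then show ?thesis using insert.IH by simp
    qed
  qed simp
  from this[of W] assms show ?thesis by (simp add: Un_absorb1)
qed

text \<open>Flipping the spin at \<open>x\<close> keeps the weight and reverses the sign of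
  \<open>\<sigma> x * \<sigma> y\<close>, so the numerator equals its own negative.\<close>

lemma two_point_isolated:
  assumes "x \<in> V" "y \<in> V" "x \<noteq> y" "\<And>e. e \<in> E \<Longrightarrow> x \<notin> e"
  shows "two_point V E \<beta> x y = 0"
proof -
  let ?S = "V \<rightarrow>\<^sub>E {-1, 1::real}"
  let ?f = "\<lambda>\<sigma> :: 'a \<Rightarrow> real. \<sigma>(x := - \<sigma> x)"
  have w: "ising_weight E \<beta> (?f \<sigma>) = ising_weight E \<beta> \<sigma>" for \<sigma>
    unfolding ising_weight_def using assms
    by (intro arg_cong[where f = exp] arg_cong[where f = "(*) \<beta>"] sum.cong prod.cong) auto
  have f: "?f \<sigma> \<in> ?S" if "\<sigma> \<in> ?S" for \<sigma>
    using that assms(1) PiE_mem[OF that assms(1)] by (auto simp: PiE_def Pi_def extensional_def)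
  have "(\<Sum>\<sigma>\<in>?S. \<sigma> x * \<sigma> y * ising_weight E \<beta> \<sigma>)
      = (\<Sum>\<sigma>\<in>?S. - (\<sigma> x * \<sigma> y * ising_weight E \<beta> \<sigma>))"
    by (rule sum.reindex_bij_witness[of _ ?f ?f]) (use f w assms(3) in auto)
  then have "(\<Sum>\<sigma>\<in>?S. \<sigma> x * \<sigma> y * ising_weight E \<beta> \<sigma>) = 0"
    by (simp add: sum_negf)
  then show ?thesis by (simp add: two_point_def ising_expectation_def)
qed

text \<open>Expanding the edge gives a numerator with coefficients \<open>cosh \<beta>\<close> and
  \<open>sinh \<beta>\<close>, while by the first Griffiths inequality the partition function is at
  least \<open>cosh \<beta>\<close> times the one without the edge; the quotient of the coefficients
  is \<open>tanh \<beta>\<close>.\<close>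

lemma two_point_remove_edge:
  assumes V: "finite V" and E: "insert {x, y} E \<subseteq> Pow V" "{x, y} \<notin> E" and xy: "x \<noteq> y"
    and z: "z \<in> V" and \<beta>: "0 \<le> \<beta>"
  shows "two_point V (insert {x, y} E) \<beta> x z \<le> two_point V E \<beta> x z + tanh \<beta> * two_point V E \<beta> y z"
proof -
  define J where "J = (\<lambda>_::'a set. \<beta>)"
  have xyV: "x \<in> V" "y \<in> V" and EP: "E \<subseteq> Pow V" using E by auto
  have fE: "finite E" using V E finite_edges[of V E] by auto
  let ?N = "\<lambda>u. spin_sum V E J (pair_set u z)"
  let ?Z = "spin_sum V E J {}"
  have N: "two_point V E \<beta> u z = ?N u / ?Z" if "u \<in> V" for u
    using V E fE z that by (intro two_point_eq) (auto simp: J_def)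
  have c: "0 < cosh \<beta>" by (rule cosh_real_pos)
  \<comment> \<open>Crossing the edge moves the endpoint from \<open>x\<close> to \<open>y\<close>;
    the cases \<open>z = x\<close> and \<open>z = y\<close> fit because the pair set of equal points
    is empty.\<close>
  have "(pair_set x z - {x, y}) \<union> ({x, y} - pair_set x z) = pair_set y z"
    using xy by (auto simp: pair_set_def)
  then have 1: "spin_sum V (insert {x, y} E) J (pair_set x z) = cosh \<beta> * ?N x + sinh \<beta> * ?N y"
    using spin_sum_insert[OF V fE E(2), of "pair_set x z" J] xyV z pair_set_subset[of x V z]
    by (simp add: J_def)
  have "0 \<le> spin_sum V E J {x, y}"
    using V fE EP xyV \<beta> by (intro griffiths_first) (auto simp: J_def)
  then have 2: "cosh \<beta> * ?Z \<le> spin_sum V (insert {x, y} E) J {}"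
    using spin_sum_insert[OF V fE E(2), of "{}" J] xyV \<beta> by (simp add: J_def)
  have Zpos: "0 < ?Z" by (rule spin_sum_empty_pos[OF V])
  have "0 \<le> ?N u" if "u \<in> V" for u
    using V fE EP z \<beta> that pair_set_subset[of u V z] by (intro griffiths_first) (auto simp: J_def)
  then have "0 \<le> cosh \<beta> * ?N x + sinh \<beta> * ?N y"
    using xyV \<beta> c by (intro add_nonneg_nonneg mult_nonneg_nonneg) auto
  then have "(cosh \<beta> * ?N x + sinh \<beta> * ?N y) / spin_sum V (insert {x, y} E) J {}
      \<le> (cosh \<beta> * ?N x + sinh \<beta> * ?N y) / (cosh \<beta> * ?Z)"
    using 2 Zpos c by (intro divide_left_mono mult_pos_pos spin_sum_empty_pos[OF V]) auto
  also have "\<dots> = ?N x / ?Z + tanh \<beta> * (?N y / ?Z)"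
    using c Zpos by (simp add: tanh_def field_simps)
  also have "(cosh \<beta> * ?N x + sinh \<beta> * ?N y) / spin_sum V (insert {x, y} E) J {}
      = two_point V (insert {x, y} E) \<beta> x z"
    unfolding 1[symmetric] using V E fE z xyV
    by (intro two_point_eq[symmetric]) (auto simp: J_def)
  finally show ?thesis using N[OF xyV(1)] N[OF xyV(2)] by simp
qed

text \<open>Each removal leaves a correlation of a thinned graph; monotonicity raises it to the full
  graph, so that the error terms form one sum.\<close>

lemma two_point_remove_edges:
  assumes V: "finite V" and E: "E \<subseteq> Pow V" and x: "x \<in> V" and z: "z \<in> V" and \<beta>: "0 \<le> \<beta>"
    and N: "finite N" "x \<notin> N" "\<And>y. y \<in> N \<Longrightarrow> {x, y} \<in> E"
  shows "two_point V E \<beta> x z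
    \<le> two_point V (E - (\<lambda>y. {x, y}) ` N) \<beta> x z + tanh \<beta> * (\<Sum>y\<in>N. two_point V E \<beta> y z)"
  using N
proof (induction N rule: finite_induct)
  case (insert y N)
  let ?E = "E - (\<lambda>y. {x, y}) ` insert y N"
  have y: "y \<in> V" "x \<noteq> y" "{x, y} \<in> E" using insert.prems E by blast+
  have "E - (\<lambda>y. {x, y}) ` N = insert {x, y} ?E"
    using y insert.hyps by (auto simp: doubleton_eq_iff)
  then have "two_point V E \<beta> x z
      \<le> two_point V (insert {x, y} ?E) \<beta> x z + tanh \<beta> * (\<Sum>y\<in>N. two_point V E \<beta> y z)"
    using insert.IH insert.prems by simp
  also have "two_point V (insert {x, y} ?E) \<beta> x z
      \<le> two_point V ?E \<beta> x z + tanh \<beta> * two_point V ?E \<beta> y z"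
    using V E x y z \<beta> by (intro two_point_remove_edge) auto
  also have "tanh \<beta> * two_point V ?E \<beta> y z \<le> tanh \<beta> * two_point V E \<beta> y z"
    using V E y z \<beta> by (intro mult_left_mono two_point_mono) auto
  finally show ?case using insert.hyps by (simp add: algebra_simps)
qed simp

text \<open>Once all its edges are removed, \<open>x\<close> is isolated and only the error terms
  remain, unless \<open>x = z\<close>, where the left side is 1.\<close>

lemma two_point_le_sum_neighbours:
  assumes V: "finite V" and E: "E \<subseteq> Pow V" "\<And>e. e \<in> E \<Longrightarrow> card e = 2"
    and x: "x \<in> V" and z: "z \<in> V" and \<beta>: "0 \<le> \<beta>"
  shows "two_point V E \<beta> x z
    \<le> of_bool (x = z) + tanh \<beta> * (\<Sum>y | y \<in> V \<and> {x, y} \<in> E. two_point V E \<beta> y z)"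
proof (cases "x = z")
  case True
  then show ?thesis
    using V E x z \<beta> two_point_self[OF V z, of E \<beta>]
    by (auto intro!: mult_nonneg_nonneg sum_nonneg two_point_nonneg)
next
  case False
  let ?N = "{y. y \<in> V \<and> {x, y} \<in> E}"
  have "two_point V E \<beta> x z
      \<le> two_point V (E - (\<lambda>y. {x, y}) ` ?N) \<beta> x z + tanh \<beta> * (\<Sum>y\<in>?N. two_point V E \<beta> y z)"
    \<comment> \<open>The cardinality condition applied to \<open>{x}\<close> excludes a loop, so
      \<open>x\<close> is not its own neighbour.\<close>
    using V E(1) x z \<beta> E(2)[of "{x}"] by (intro two_point_remove_edges) auto
  also have "two_point V (E - (\<lambda>y. {x, y}) ` ?N) \<beta> x z = 0"
  proof (rule two_point_isolated[OF x z False])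
    fix e assume e: "e \<in> E - (\<lambda>y. {x, y}) ` ?N"
    show "x \<notin> e"
    proof
      assume xe: "x \<in> e"
      obtain u v where "e = {u, v}" using E(2) e by (meson card_2_iff DiffD1)
      with xe obtain y where "e = {x, y}" by blast
      with e E(1) show False by auto
    qed
  qed
  finally show ?thesis using False by simp
qed

text \<open>Summing the previous bound over \<open>x\<close> gives \<open>S \<le> 1 + D * tanh \<beta> * S\<close> for
  the susceptibility \<open>S\<close>, uniformly in the graph.\<close>

lemma sum_two_point_le:
  assumes V: "finite V" and E: "E \<subseteq> Pow V" "\<And>e. e \<in> E \<Longrightarrow> card e = 2" and z: "z \<in> V" and \<beta>: "0 \<le> \<beta>"
    and deg: "\<And>y. y \<in> V \<Longrightarrow> card {x \<in> V. {x, y} \<in> E} \<le> D" and D: "real D * tanh \<beta> \<le> 1 / 2"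
  shows "(\<Sum>x\<in>V. two_point V E \<beta> x z) \<le> 2"
proof -
  let ?S = "\<Sum>x\<in>V. two_point V E \<beta> x z"
  have nn: "0 \<le> two_point V E \<beta> y z" if "y \<in> V" for y
    using V E z \<beta> that by (intro two_point_nonneg) auto
  have "?S \<le> (\<Sum>x\<in>V. of_bool (x = z) + tanh \<beta> * (\<Sum>y | y \<in> V \<and> {x, y} \<in> E. two_point V E \<beta> y z))"
    using V E z \<beta> by (intro sum_mono two_point_le_sum_neighbours) auto
  also have "\<dots> = 1 + tanh \<beta> * (\<Sum>x\<in>V. \<Sum>y | y \<in> V \<and> {x, y} \<in> E. two_point V E \<beta> y z)"
    using V z by (simp add: sum.distrib sum_distrib_left of_bool_def sum.delta)
  \<comment> \<open>After the exchange each \<open>y\<close> is counted once per neighbour, which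
    the degree bound controls.\<close>
  also have "(\<Sum>x\<in>V. \<Sum>y | y \<in> V \<and> {x, y} \<in> E. two_point V E \<beta> y z)
      = (\<Sum>y\<in>V. \<Sum>x | x \<in> V \<and> {x, y} \<in> E. two_point V E \<beta> y z)"
    using V by (rule sum.swap_restrict) (rule V)
  also have "\<dots> = (\<Sum>y\<in>V. real (card {x \<in> V. {x, y} \<in> E}) * two_point V E \<beta> y z)"
    by simp
  also have "1 + tanh \<beta> * \<dots> \<le> 1 + tanh \<beta> * (\<Sum>y\<in>V. real D * two_point V E \<beta> y z)"
    using \<beta> deg nn by (intro add_left_mono mult_left_mono sum_mono mult_right_mono) auto
  also have "\<dots> = 1 + (real D * tanh \<beta>) * ?S"
    by (simp add: sum_distrib_left mult_ac)
  also have "(real D * tanh \<beta>) * ?S \<le> 1 / 2 * ?S"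
    using D nn by (intro mult_right_mono sum_nonneg) auto
  finally show ?thesis by simp
qed

section \<open>Boxes and tori\<close>

definition int_cube :: "int set \<Rightarrow> (int ^ 'd::finite) set" where
  "int_cube A = {x. \<forall>i. x $ i \<in> A}"

lemma int_cube:
  assumes "finite A"
  shows "finite (int_cube A :: (int ^ 'd::finite) set)"
    and "card (int_cube A :: (int ^ 'd) set) = card A ^ CARD('d)"
proof -
  have "bij_betw vec_lambda ((UNIV :: 'd set) \<rightarrow>\<^sub>E A) (int_cube A)"
    by (rule bij_betw_byWitness[where f' = vec_nth]) (auto simp: int_cube_def PiE_def)
  moreover have "finite ((UNIV :: 'd set) \<rightarrow>\<^sub>E A)" using assms by (intro finite_PiE) auto
  moreover have "card ((UNIV :: 'd set) \<rightarrow>\<^sub>E A) = card A ^ CARD('d)"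
    by (simp add: card_PiE)
  ultimately show "finite (int_cube A :: (int ^ 'd) set)"
    "card (int_cube A :: (int ^ 'd) set) = card A ^ CARD('d)"
    using bij_betw_finite bij_betw_same_card by metis+
qed

lemma lattice_box_eq: "lattice_box r = int_cube {\<lceil>- (real r / 2)\<rceil> ..< \<lceil>real r / 2\<rceil>}"
  by (auto simp: lattice_box_def int_cube_def ceiling_le_iff less_ceiling_iff)

lemma finite_lattice_box [simp]: "finite (lattice_box r)"
  by (simp add: lattice_box_eq int_cube)

lemma card_lattice_box: "card (lattice_box r :: (int ^ 'd::finite) set) = r ^ CARD('d)"
proof -
  \<comment> \<open>The half-open interval has integer length \<open>r\<close>, so its rounded
    endpoints differ by exactly \<open>r\<close>, whatever the parity.\<close>
  have "\<lceil>real r / 2\<rceil> = \<lceil>- (real r / 2) + of_int (int r)\<rceil>"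
    by (rule arg_cong[where f = ceiling]) simp
  also have "\<dots> = \<lceil>- (real r / 2)\<rceil> + int r" by (rule ceiling_add_of_int)
  finally have "card {\<lceil>- (real r / 2)\<rceil> ..< \<lceil>real r / 2\<rceil>} = r" by simp
  then show ?thesis by (simp add: lattice_box_eq int_cube)
qed

lemma zero_in_lattice_box: "0 < r \<Longrightarrow> 0 \<in> lattice_box r"
  by (simp add: lattice_box_def)

lemma lattice_box_mono:
  assumes "r \<le> s"
  shows "lattice_box r \<subseteq> lattice_box s"
proof -
  have "real r \<le> real s" using assms by simp
  then have "- (real s / 2) \<le> - (real r / 2)" "real r / 2 \<le> real s / 2" by simp_all
  then show ?thesis unfolding lattice_box_def using order_trans less_le_trans by blast
qed

lemma eventually_in_lattice_box: "eventually (\<lambda>r. x \<in> lattice_box r) sequentially"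
proof -
  \<comment> \<open>The sum of the absolute coordinates dominates each of them; the added 1 makes
    the upper bound \<open>r / 2\<close> strict.\<close>
  define M where "M = nat (2 * (\<Sum>i\<in>UNIV. \<bar>x $ i\<bar>) + 1)"
  have "x \<in> lattice_box r" if "r \<ge> M" for r
  proof -
    have "- (real r / 2) \<le> real_of_int (x $ i) \<and> real_of_int (x $ i) < real r / 2" for i
    proof -
      have "\<bar>x $ i\<bar> \<le> (\<Sum>i\<in>UNIV. \<bar>x $ i\<bar>)" by (rule member_le_sum) auto
      then have "2 * \<bar>x $ i\<bar> < int r" using that unfolding M_def by linarith
      then have "real_of_int (2 * \<bar>x $ i\<bar>) < real_of_int (int r)" by (rule of_int_less_iff[THEN iffD2])
      then show ?thesis by simp linarith
    qed
    then show ?thesis by (simp add: lattice_box_def)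
  qed
  then show ?thesis unfolding eventually_sequentially by blast
qed

lemma box_edges_subset: "box_edges r \<subseteq> Pow (lattice_box r)"
  by (auto simp: box_edges_def)

lemma torus_edges_subset: "torus_edges r \<subseteq> Pow (lattice_box r)"
  by (auto simp: torus_edges_def)

lemma box_edges_mono: "r \<le> s \<Longrightarrow> box_edges r \<subseteq> box_edges s"
  unfolding box_edges_def using lattice_box_mono[of r s] by blast

lemma card_box_edge:
  assumes "e \<in> (box_edges r :: (int ^ 'd::finite) set set)"
  shows "card e = 2"
proof -
  obtain y :: "int ^ 'd" and i where e: "e = {y + axis i 1, y}"
    using assms by (auto simp: box_edges_def)
  have "y + axis i 1 \<noteq> y" by (simp add: axis_eq_0_iff)
  then show ?thesis using e by simp
qed

lemma card_box_neighbours: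
  fixes y :: "int ^ 'd::finite"
  shows "card {x \<in> lattice_box r. {x, y} \<in> box_edges r} \<le> 2 * CARD('d)"
proof -
  let ?N = "range (\<lambda>i. y + axis i 1) \<union> range (\<lambda>i. y - axis i 1)"
  have "{x \<in> lattice_box r. {x, y} \<in> box_edges r} \<subseteq> ?N"
    unfolding box_edges_def by (fastforce simp: doubleton_eq_iff)
  then have "card {x \<in> lattice_box r. {x, y} \<in> box_edges r} \<le> card ?N"
    by (intro card_mono) auto
  also have "\<dots> \<le> card (range (\<lambda>i. y + axis i 1)) + card (range (\<lambda>i. y - axis i 1))"
    by (rule card_Un_le)
  also have "\<dots> \<le> CARD('d) + CARD('d)" by (intro add_mono card_image_le) auto
  finally show ?thesis by simp
qed

section \<open>The infinite-volume two-point function and its susceptibility\<close>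

lemma tau_box_mono:
  assumes "r \<le> s" "0 \<le> \<beta>" "x \<in> lattice_box r" "y \<in> lattice_box r"
  shows "tau_box r \<beta> x y \<le> tau_box s \<beta> x y"
proof -
  have xy: "x \<in> lattice_box s" "y \<in> lattice_box s"
    using assms lattice_box_mono by blast+
  \<comment> \<open>The box grows in two stages: new vertices enter as isolated ones, then the new
    edges are added.\<close>
  have "tau_box r \<beta> x y = two_point (lattice_box s) (box_edges r) \<beta> x y"
    unfolding tau_box_def
    by (rule two_point_enlarge_vertices[symmetric])
      (fact finite_lattice_box lattice_box_mono[OF assms(1)] box_edges_subset assms)+
  also have "\<dots> \<le> tau_box s \<beta> x y"
    unfolding tau_box_def
    by (rule two_point_mono)
      (fact finite_lattice_box box_edges_subset box_edges_mono[OF assms(1)] assms(2) order_refl xy)+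
  finally show ?thesis .
qed

text \<open>Bounded monotone convergence, after discarding the finitely many boxes that may miss
  \<open>x\<close> or \<open>y\<close>. This makes the \<open>lim\<close> in \<open>tau\<close>
  meaningful.\<close>

lemma tau_box_tendsto:
  assumes "0 \<le> \<beta>"
  shows "(\<lambda>r. tau_box r \<beta> x y) \<longlonglongrightarrow> tau \<beta> x y"
proof -
  obtain N where N: "x \<in> lattice_box r" "y \<in> lattice_box r" if "r \<ge> N" for r
    using eventually_conj[OF eventually_in_lattice_box[of x] eventually_in_lattice_box[of y]]
    unfolding eventually_sequentially by auto
  have "convergent (\<lambda>r. tau_box (r + N) \<beta> x y)"
  proof (rule Bseq_monoseq_convergent)
    have "norm (tau_box (r + N) \<beta> x y) \<le> 1" for r
    proof -
      have xy: "x \<in> lattice_box (r + N)" "y \<in> lattice_box (r + N)" using N by simp_all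
      then show ?thesis
        using two_point_nonneg[OF finite_lattice_box box_edges_subset assms xy]
          two_point_le_1[OF finite_lattice_box xy] by (simp add: tau_box_def)
    qed
    then show "Bseq (\<lambda>r. tau_box (r + N) \<beta> x y)" by (rule BseqI')
    show "monoseq (\<lambda>r. tau_box (r + N) \<beta> x y)"
      using N assms by (intro monoI1 allI impI tau_box_mono) auto
  qed
  then have "convergent (\<lambda>r. tau_box r \<beta> x y)"
    using convergent_ignore_initial_segment[of "\<lambda>r. tau_box r \<beta> x y" N] by blast
  then show ?thesis unfolding tau_def by (rule convergent_LIMSEQ_iff[THEN iffD1])
qed

lemma tau_nonneg:
  assumes "0 \<le> \<beta>"
  shows "0 \<le> tau \<beta> x y"
proof (rule tendsto_lowerbound[OF tau_box_tendsto[OF assms]])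
  show "\<forall>\<^sub>F r in sequentially. 0 \<le> tau_box r \<beta> x y"
    using eventually_conj[OF eventually_in_lattice_box[of x] eventually_in_lattice_box[of y]]
    by eventually_elim (use assms box_edges_subset in \<open>auto simp: tau_box_def intro!: two_point_nonneg\<close>)
qed simp

lemma tau_self:
  assumes "0 \<le> \<beta>"
  shows "tau \<beta> x x = 1"
proof (rule LIMSEQ_unique[OF tau_box_tendsto[OF assms]])
  have "\<forall>\<^sub>F r in sequentially. tau_box r \<beta> x x = 1"
    using eventually_in_lattice_box[of x]
    by eventually_elim (simp add: tau_box_def two_point_self)
  then show "(\<lambda>r. tau_box r \<beta> x x) \<longlonglongrightarrow> 1" by (rule tendsto_eventually)
qed

lemma chi_eq_SUP:
  assumes "0 \<le> \<beta>"
  shows "chi TYPE('d::finite) \<beta>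
    = (SUP F\<in>{F :: (int ^ 'd) set. finite F}. ereal (\<Sum>x\<in>F. tau \<beta> 0 x))"
  unfolding chi_def using tau_nonneg[OF assms] by (subst nonneg_infsum_complete) auto

lemma sum_tau_le_chi:
  fixes F :: "(int ^ 'd::finite) set"
  assumes "0 \<le> \<beta>" "finite F"
  shows "ereal (\<Sum>x\<in>F. tau \<beta> 0 x) \<le> chi TYPE('d) \<beta>"
  unfolding chi_eq_SUP[OF assms(1)] using assms(2) by (intro SUP_upper) auto

lemma chi_ge_1:
  assumes "0 \<le> \<beta>"
  shows "1 \<le> chi TYPE('d::finite) \<beta>"
  using sum_tau_le_chi[OF assms, of "{0 :: int ^ 'd}"] by (simp add: tau_self[OF assms] one_ereal_def)

text \<open>A finite partial sum is dominated by the full sum over any box containing it; the bound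
  for boxes, of degree at most \<open>2 * CARD('d)\<close>, is uniform in \<open>r\<close> and
  survives the limit.\<close>

lemma chi_le_2:
  assumes "0 \<le> \<beta>" and t: "real (2 * CARD('d::finite)) * tanh \<beta> \<le> 1 / 2"
  shows "chi TYPE('d) \<beta> \<le> 2"
  unfolding chi_eq_SUP[OF assms(1)]
proof (rule SUP_least)
  fix F :: "(int ^ 'd) set" assume "F \<in> {F. finite F}"
  then have F: "finite F" by simp
  have "(\<Sum>x\<in>F. tau \<beta> 0 x) \<le> 2"
  proof (rule tendsto_upperbound)
    show "(\<lambda>r. \<Sum>x\<in>F. tau_box r \<beta> 0 x) \<longlonglongrightarrow> (\<Sum>x\<in>F. tau \<beta> 0 x)"
      by (intro tendsto_sum tau_box_tendsto assms(1))
    have "\<forall>\<^sub>F r in sequentially. \<forall>x\<in>F. x \<in> lattice_box r"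
      using F eventually_in_lattice_box by (intro eventually_ball_finite) auto
    then show "\<forall>\<^sub>F r in sequentially. (\<Sum>x\<in>F. tau_box r \<beta> 0 x) \<le> 2"
      using eventually_gt_at_top[of 0]
    proof eventually_elim
      case (elim r)
      note nn = two_point_nonneg[OF finite_lattice_box box_edges_subset assms(1) zero_in_lattice_box[OF elim(2)]]
      have "(\<Sum>x\<in>F. tau_box r \<beta> 0 x) \<le> (\<Sum>x\<in>lattice_box r. tau_box r \<beta> 0 (x :: int ^ 'd))"
        unfolding tau_box_def
        by (rule sum_mono2) (use elim(1) nn in auto)
      also have "\<dots> = (\<Sum>x\<in>lattice_box r. two_point (lattice_box r) (box_edges r) \<beta> (x :: int ^ 'd) 0)"
        by (simp add: tau_box_def two_point_commute)
      also have "\<dots> \<le> 2"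
        using assms elim(2)
        by (intro sum_two_point_le[where D = "2 * CARD('d)"] box_edges_subset card_box_edge
            card_box_neighbours zero_in_lattice_box) auto
      finally show ?case .
    qed
  qed simp
  then show "ereal (\<Sum>x\<in>F. tau \<beta> 0 x) \<le> 2" by (metis ereal_less_eq(3) numeral_eq_ereal)
qed

text \<open>As \<open>tanh\<close> tends to 0 at 0, some positive \<open>\<beta>\<close> meets the
  smallness condition of \<open>chi_le_2\<close>.\<close>

lemma crit_ereal_pos: "0 < crit_ereal TYPE('d::finite)"
proof -
  let ?D = "real (2 * CARD('d))"
  have "((\<lambda>\<beta>. ?D * tanh \<beta>) \<longlongrightarrow> ?D * tanh 0) (at_right 0)"
    by (intro tendsto_intros) auto
  then have "\<forall>\<^sub>F \<beta> in at_right 0. ?D * tanh \<beta> < 1 / 2"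
    by (rule order_tendstoD(2)) simp
  moreover have "\<forall>\<^sub>F \<beta> in at_right 0. (0::real) < \<beta>" by (rule eventually_at_right_less)
  ultimately have "\<exists>\<beta>. ?D * tanh \<beta> < 1 / 2 \<and> 0 < \<beta>"
    by (intro eventually_happens'[of "at_right (0::real)"] eventually_conj) auto
  then obtain \<beta> where \<beta>: "?D * tanh \<beta> \<le> 1 / 2" "0 < \<beta>" using less_imp_le by blast
  have "chi TYPE('d) \<beta> \<le> 2" by (rule chi_le_2) (use \<beta> in auto)
  also have "(2 :: ereal) < \<infinity>" by simp
  finally have "ereal \<beta> \<le> crit_ereal TYPE('d)"
    unfolding crit_ereal_def using \<beta>(2) by (intro SUP_upper) auto
  with \<beta>(2) show ?thesis by (metis ereal_less(2) less_le_trans)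
qed

lemma chi_torus_mono:
  assumes "0 < r" "0 \<le> \<beta>'" "\<beta>' \<le> \<beta>"
  shows "chi_torus TYPE('d::finite) r \<beta>' \<le> chi_torus TYPE('d) r \<beta>"
  unfolding chi_torus_def tau_torus_def using assms torus_edges_subset
  by (intro sum_mono two_point_mono zero_in_lattice_box) auto

lemma sup_norm_less_iff:
  "sup_norm x < c \<longleftrightarrow> (\<forall>i. \<bar>real_of_int (x $ i)\<bar> < c)"
proof -
  \<comment> \<open>The maximum is an integer, so comparing it with the real \<open>c\<close>
    amounts to comparing it with the ceiling of \<open>c\<close>.\<close>
  have "sup_norm x < c \<longleftrightarrow> (MAX i. \<bar>x $ i\<bar>) < \<lceil>c\<rceil>"
    by (simp add: sup_norm_def less_ceiling_iff)
  also have "\<dots> \<longleftrightarrow> (\<forall>i. \<bar>x $ i\<bar> < \<lceil>c\<rceil>)" by (subst Max_less_iff) auto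
  finally show ?thesis by (simp add: less_ceiling_iff)
qed

lemma finite_sup_norm_less: "finite {x :: int ^ 'd::finite. sup_norm x < c}"
proof (rule finite_subset)
  show "{x :: int ^ 'd. sup_norm x < c} \<subseteq> int_cube {-\<lceil>c\<rceil>..\<lceil>c\<rceil>}"
  proof
    fix x :: "int ^ 'd" assume "x \<in> {x. sup_norm x < c}"
    then have *: "\<bar>real_of_int (x $ i)\<bar> < c" for i by (simp add: sup_norm_less_iff)
    have "x $ i \<in> {-\<lceil>c\<rceil>..\<lceil>c\<rceil>}" for i using *[of i] by simp linarith
    then show "x \<in> int_cube {-\<lceil>c\<rceil>..\<lceil>c\<rceil>}" by (simp add: int_cube_def)
  qed
qed (simp add: int_cube)

section \<open>The torus susceptibility\<close>

text \<open>Over the box \<open>tau\<close> sums to at most the full susceptibility, and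
  \<open>B\<close> is counted once per point.\<close>

lemma chi_torus_le:
  assumes "0 \<le> \<beta>" "chi TYPE('d::finite) \<beta> = ereal X"
    and B: "\<And>x :: int ^ 'd. x \<in> lattice_box r \<Longrightarrow> tau_torus r \<beta> 0 x \<le> tau \<beta> 0 x + B"
  shows "chi_torus TYPE('d) r \<beta> \<le> X + real r ^ CARD('d) * B"
proof -
  let ?L = "lattice_box r :: (int ^ 'd) set"
  have "chi_torus TYPE('d) r \<beta> \<le> (\<Sum>x\<in>?L. tau \<beta> 0 x + B)"
    unfolding chi_torus_def by (intro sum_mono B)
  also have "\<dots> = (\<Sum>x\<in>?L. tau \<beta> 0 x) + real r ^ CARD('d) * B"
    by (simp add: sum.distrib card_lattice_box)
  finally show ?thesis
    using sum_tau_le_chi[OF assms(1), of ?L] assms(2) by simp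
qed

text \<open>The points of small norm contribute nonnegatively and are dropped. All such lattice
  points are subtracted, inside the box or not, so their number is independent of
  \<open>r\<close>.\<close>

lemma chi_torus_ge:
  assumes "0 < r" "0 \<le> \<beta>" "0 \<le> B"
    and B: "\<And>x :: int ^ 'd::finite. x \<in> lattice_box r \<Longrightarrow> c \<le> sup_norm x \<Longrightarrow> B \<le> tau_torus r \<beta> 0 x"
  shows "(real r ^ CARD('d) - real (card {x :: int ^ 'd. sup_norm x < c})) * B
    \<le> chi_torus TYPE('d) r \<beta>"
proof -
  let ?L = "lattice_box r :: (int ^ 'd) set"
  let ?C = "{x :: int ^ 'd. sup_norm x < c}"
  \<comment> \<open>This subtraction is truncated at 0; the real difference below can only be
    smaller.\<close>
  have "card ?L - card ?C \<le> card (?L - ?C)"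
    by (rule diff_card_le_card_Diff[OF finite_sup_norm_less])
  then have "real r ^ CARD('d) - real (card ?C) \<le> real (card (?L - ?C))"
    by (simp add: card_lattice_box flip: of_nat_power)
  then have "(real r ^ CARD('d) - real (card ?C)) * B \<le> (\<Sum>x\<in>?L - ?C. B)"
    using assms(3) by (simp add: mult_right_mono)
  also have "\<dots> \<le> (\<Sum>x\<in>?L - ?C. tau_torus r \<beta> 0 x)"
    by (intro sum_mono B) auto
  also have "\<dots> \<le> chi_torus TYPE('d) r \<beta>"
    unfolding chi_torus_def tau_torus_def
    using two_point_nonneg[OF finite_lattice_box torus_edges_subset assms(2) zero_in_lattice_box[OF assms(1)]]
    by (intro sum_mono2) auto
  finally show ?thesis .
qed

theorem corollary1p3:
  fixes c0 C0 c1 c2 c3 c4 c5 :: real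
  assumes dim: "CARD('d::finite) > 4"
    and chi_mean_field: "\<exists>k K. 0 < k \<and> 0 < K \<and>
      (\<forall>\<beta>. 0 < \<beta> \<and> ereal \<beta> < crit_ereal TYPE('d) \<longrightarrow>
        ereal k / (crit_ereal TYPE('d) - ereal \<beta>) \<le> chi TYPE('d) \<beta> \<and>
        chi TYPE('d) \<beta> \<le> ereal K / (crit_ereal TYPE('d) - ereal \<beta>))"
    and c_pos: "0 < c0" "0 < C0" "0 < c1" "0 < c2" "0 < c3" "0 < c4" "0 < c5"
    and c3_eq: "c3 = 4 / 9 * c0\<^sup>2"
    and tau_upper: "\<And>\<beta> (x :: int ^ 'd). 0 < \<beta> \<Longrightarrow> \<beta> \<le> crit TYPE('d) \<Longrightarrow>
      tau \<beta> 0 x \<le> C0 / max 1 (sup_norm x) ^ (CARD('d) - 2)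
        * exp (- c0 * sqrt (crit TYPE('d) - \<beta>) * sup_norm x)"
    and tau_lower: "\<And>\<beta> (x :: int ^ 'd). 0 < \<beta> \<Longrightarrow> \<beta> \<le> crit TYPE('d) \<Longrightarrow>
      \<beta> = crit TYPE('d) \<or> sup_norm x \<le> c0 * (crit TYPE('d) - \<beta>) powr (- 1 / 2) \<Longrightarrow>
      tau \<beta> 0 x \<ge> c0 / max 1 (sup_norm x) ^ (CARD('d) - 2)"
    and torus_upper: "\<And>r \<beta> (x :: int ^ 'd). 3 \<le> r \<Longrightarrow> 0 < \<beta> \<Longrightarrow> \<beta> < crit TYPE('d) \<Longrightarrow>
      x \<in> lattice_box r \<Longrightarrow>
      ereal (tau_torus r \<beta> 0 x)
        \<le> ereal (tau \<beta> 0 x) + ereal c1 * chi TYPE('d) \<beta> / ereal (real r ^ CARD('d))"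
    and torus_lower: "\<And>r \<beta> (x :: int ^ 'd). 3 \<le> r \<Longrightarrow> 0 < \<beta> \<Longrightarrow>
      crit TYPE('d) - c3 / (real r)\<^sup>2 \<le> \<beta> \<Longrightarrow>
      \<beta> \<le> beta_star TYPE('d) c4 r \<Longrightarrow>
      x \<in> lattice_box r \<Longrightarrow> c5 \<le> sup_norm x \<Longrightarrow>
      ereal (tau_torus r \<beta> 0 x)
        \<ge> ereal (tau \<beta> 0 x) + ereal c2 * chi TYPE('d) \<beta> / ereal (real r ^ CARD('d))"
  shows "\<exists>r0\<ge>3.
    (\<exists>a A. 0 < a \<and> a \<le> A \<and> (\<forall>r\<ge>r0.
       a * real r powr (real CARD('d) / 2) \<le> chi_torus TYPE('d) r (beta_star TYPE('d) c4 r) \<and>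
       chi_torus TYPE('d) r (beta_star TYPE('d) c4 r) \<le> A * real r powr (real CARD('d) / 2))) \<and>
    (\<exists>a>0. \<forall>r\<ge>r0. \<forall>\<beta>\<ge>beta_star TYPE('d) c4 r.
       chi_torus TYPE('d) r \<beta> \<ge> a * real r powr (real CARD('d) / 2))"
proof -
  let ?d = "CARD('d)"
  define c where "c = crit TYPE('d)"
  define R where "R r = real r powr (real ?d / 2)" for r :: nat
  define M where "M = card {x :: int ^ 'd. sup_norm x < c5}"
  obtain k K where kK: "0 < k" "0 < K" and
    chi_ge: "\<And>\<beta>. 0 < \<beta> \<Longrightarrow> ereal \<beta> < crit_ereal TYPE('d) \<Longrightarrow>
        ereal k / (crit_ereal TYPE('d) - ereal \<beta>) \<le> chi TYPE('d) \<beta>" and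
    chi_le: "\<And>\<beta>. 0 < \<beta> \<Longrightarrow> ereal \<beta> < crit_ereal TYPE('d) \<Longrightarrow>
        chi TYPE('d) \<beta> \<le> ereal K / (crit_ereal TYPE('d) - ereal \<beta>)"
    using chi_mean_field by blast
  have "crit_ereal TYPE('d) \<noteq> \<infinity>"
  proof
    assume inf: "crit_ereal TYPE('d) = \<infinity>"
    then have "chi TYPE('d) 1 \<le> 0" using chi_le[of 1] by simp
    with chi_ge_1[of 1, where 'd = 'd] have "(1 :: ereal) \<le> 0" by (meson order_trans zero_le_one)
    then show False by simp
  qed
  with crit_ereal_pos[where 'd = 'd] have crit: "crit_ereal TYPE('d) = ereal c" "0 < c"
    unfolding c_def crit_def by (cases "crit_ereal TYPE('d)"; auto)+

  \<comment> \<open>In order, the entries ensure the range of the torus bounds,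
    \<open>beta_star > 0\<close>, that \<open>beta_star\<close> lies in the window of the lower
    bound, and that at most half of the torus is discarded.\<close>
  define r0 where "r0 = Max {3, nat \<lceil>c4 / c\<rceil> + 1, nat \<lceil>(c4 / c3)\<^sup>2\<rceil>, 2 * M}"
  \<comment> \<open>At distance \<open>c4 / R r\<close> below the critical point the susceptibility
    lies between \<open>k / c4 * R r\<close> and \<open>K / c4 * R r\<close>. The factor 1/2 in
    \<open>a\<close> accounts for the discarded points; the maximum in \<open>A\<close> ensures
    \<open>a \<le> A\<close>.\<close>
  define a where "a = c2 * k / (2 * c4)"
  define A where "A = max a ((1 + c1) * K / c4)"
  have a: "0 < a" using kK c_pos by (simp add: a_def)

  have bounds: "a * R r \<le> chi_torus TYPE('d) r (beta_star TYPE('d) c4 r)"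
      "chi_torus TYPE('d) r (beta_star TYPE('d) c4 r) \<le> A * R r"
      "0 \<le> beta_star TYPE('d) c4 r"
    if r: "r \<ge> r0" for r
  proof -
    let ?b = "beta_star TYPE('d) c4 r"
    have r3: "3 \<le> r" and r1: "nat \<lceil>c4 / c\<rceil> + 1 \<le> r" and r2: "nat \<lceil>(c4 / c3)\<^sup>2\<rceil> \<le> r" and rM: "2 * M \<le> r"
      using r unfolding r0_def by auto
    have Rpos: "0 < R r" using r3 by (simp add: R_def)
    \<comment> \<open>The integer dimension exceeds 4, so the exponent is at least 5/2; the half
      power beyond \<open>r^2\<close> has to beat the constant \<open>c4 / c3\<close>.\<close>
    have "real r powr (2 + 1 / 2) \<le> R r"
      unfolding R_def using r3 dim by (intro powr_mono) auto
    moreover have "real r powr (2 + 1 / 2) = (real r)\<^sup>2 * sqrt (real r)"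
      unfolding powr_add using r3 by (simp add: powr_half_sqrt)
    ultimately have Rsqrt: "(real r)\<^sup>2 * sqrt (real r) \<le> R r" by simp
    have sq1: "1 \<le> sqrt (real r)" using r3 by simp
    have "real r * 1 \<le> (real r)\<^sup>2 * sqrt (real r)"
      using r3 sq1 by (intro mult_mono) (auto simp: power2_eq_square)
    then have rR: "real r \<le> R r" using Rsqrt by simp
    have b_eq: "?b = c - c4 / R r"
      unfolding beta_star_def c_def R_def powr_minus divide_inverse ..
    have "c4 / c < real r" using r1 by linarith
    then have "c4 / c < R r" using rR by simp
    then have bpos: "0 < ?b" unfolding b_eq using crit(2) Rpos by (simp add: field_simps)
    have blt: "ereal ?b < crit_ereal TYPE('d)" "?b < c" using b_eq crit Rpos c_pos by auto
    \<comment> \<open>The gap \<open>c4 / R r\<close> must not exceed \<open>c3 / r^2\<close> for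
      the lower torus bound to apply.\<close>
    have "(c4 / c3)\<^sup>2 \<le> real r" using r2 by linarith
    then have "c4 / c3 \<le> sqrt (real r)" by (rule real_le_rsqrt)
    then have "c4 / c3 * (real r)\<^sup>2 \<le> sqrt (real r) * (real r)\<^sup>2"
      by (rule mult_right_mono) simp
    then have "c4 / c3 * (real r)\<^sup>2 \<le> R r" using Rsqrt by (simp only: mult.commute)
    then have "c4 / R r \<le> c3 / (real r)\<^sup>2" using c_pos r3 Rpos by (simp add: field_simps)
    then have bge: "crit TYPE('d) - c3 / (real r)\<^sup>2 \<le> ?b" using b_eq c_def by simp

    have "crit_ereal TYPE('d) - ereal ?b = ereal (c4 / R r)" using crit b_eq by simp
    then have chi: "ereal (k / c4 * R r) \<le> chi TYPE('d) ?b" "chi TYPE('d) ?b \<le> ereal (K / c4 * R r)"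
      using chi_ge[OF bpos blt(1)] chi_le[OF bpos blt(1)] Rpos c_pos by (simp_all add: mult.commute)
    then obtain X where X: "chi TYPE('d) ?b = ereal X"
      by (cases "chi TYPE('d) ?b") auto
    have Xb: "k / c4 * R r \<le> X" "X \<le> K / c4 * R r" using chi X by simp_all
    have "0 \<le> k / c4 * R r" using kK c_pos Rpos by simp
    then have Xnn: "0 \<le> X" using Xb by linarith
    have rd: "0 < real r ^ ?d" using r3 by simp

    have "chi_torus TYPE('d) r ?b \<le> X + real r ^ ?d * (c1 * X / real r ^ ?d)"
    proof (rule chi_torus_le[OF _ X])
      fix x :: "int ^ 'd" assume "x \<in> lattice_box r"
      from torus_upper[OF r3 bpos _ this] show "tau_torus r ?b 0 x \<le> tau ?b 0 x + c1 * X / real r ^ ?d"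
        using blt(2) rd X by (simp add: c_def)
    qed (use bpos in simp)
    also have "\<dots> = (1 + c1) * X" using rd by (simp add: field_simps)
    also have "\<dots> \<le> (1 + c1) * (K / c4 * R r)" using Xb c_pos by (intro mult_left_mono) auto
    also have "\<dots> = ((1 + c1) * K / c4) * R r" by simp
    also have "\<dots> \<le> A * R r" using Rpos by (intro mult_right_mono) (auto simp: A_def)
    finally show "chi_torus TYPE('d) r ?b \<le> A * R r" .

    have "a * R r = c2 / 2 * (k / c4 * R r)" by (simp add: a_def)
    also have "\<dots> \<le> c2 / 2 * X" using Xb(1) c_pos by (intro mult_left_mono) auto
    also have "\<dots> = (real r ^ ?d / 2) * (c2 * X / real r ^ ?d)" using rd by simp
    also have "\<dots> \<le> (real r ^ ?d - real M) * (c2 * X / real r ^ ?d)"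
    proof (rule mult_right_mono)
      \<comment> \<open>Together these give \<open>M \<le> r / 2 \<le> r^d / 2\<close>.\<close>
      have "real r \<le> real r ^ ?d" using r3 dim by (intro self_le_power) auto
      moreover have "2 * real M \<le> real r" using rM by linarith
      ultimately show "real r ^ ?d / 2 \<le> real r ^ ?d - real M" by linarith
    qed (use c_pos Xnn in simp)
    also have "\<dots> \<le> chi_torus TYPE('d) r ?b"
      unfolding M_def
    proof (rule chi_torus_ge)
      fix x :: "int ^ 'd" assume x: "x \<in> lattice_box r" "c5 \<le> sup_norm x"
      \<comment> \<open>The nonnegative term \<open>tau\<close> is dropped: the plateau alone has
        the required order.\<close>
      have "tau ?b 0 x + c2 * X / real r ^ ?d \<le> tau_torus r ?b 0 x"
        using torus_lower[OF r3 bpos bge order_refl x] rd X by simp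
      then show "c2 * X / real r ^ ?d \<le> tau_torus r ?b 0 x"
        using tau_nonneg[of ?b 0 x] bpos by linarith
    qed (use r3 bpos c_pos Xnn in auto)
    finally show "a * R r \<le> chi_torus TYPE('d) r ?b" .
    show "0 \<le> ?b" using bpos by simp
  qed
  have mono: "a * R r \<le> chi_torus TYPE('d) r \<beta>"
    if "r \<ge> r0" "\<beta> \<ge> beta_star TYPE('d) c4 r" for r \<beta>
  proof -
    \<comment> \<open>Monotonicity starts from a nonnegative parameter, which the third part of
      \<open>bounds\<close> provides.\<close>
    have "0 < r" using that(1) by (auto simp: r0_def)
    from chi_torus_mono[where 'd = 'd, OF this bounds(3)[OF that(1)] that(2)] bounds(1)[OF that(1)]
    show ?thesis by linarith
  qed
  have "3 \<le> r0" by (simp add: r0_def)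
  moreover have "\<exists>a A. 0 < a \<and> a \<le> A \<and> (\<forall>r\<ge>r0.
      a * R r \<le> chi_torus TYPE('d) r (beta_star TYPE('d) c4 r) \<and>
      chi_torus TYPE('d) r (beta_star TYPE('d) c4 r) \<le> A * R r)"
    using a bounds(1,2) by (intro exI[of _ a] exI[of _ A]) (auto simp: A_def)
  moreover have "\<exists>a>0. \<forall>r\<ge>r0. \<forall>\<beta>\<ge>beta_star TYPE('d) c4 r. a * R r \<le> chi_torus TYPE('d) r \<beta>"
    using a mono by (intro exI[of _ a]) auto
  ultimately show ?thesis
    unfolding R_def by (intro exI[of _ r0] conjI)
qed

end
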